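(* Let $G$ be a finite graph. The graph multiplihedron $\mathcal{J}G$ is a simple polytope only when $G$ is a complete graph.
   Context: Graphs are finite, simple, with at least one node. A tube of $G$ is a nonempty set of nodes whose induced subgraph is connected; in addition, the set of all nodes of $G$ (whether or not $G$ is connected) is considered a tube, called the universal tube. Two distinct tubes $u_1,u_2$ intersect if $u_1\cap u_2\ne\emptyset$, $u_1\not\subset u_2$ and $u_2\not\subset u_1$; they are adjacent if $u_1\cap u_2=\emptyset$ and $u_1\cup u_2$ is a tube; they are compatible if they neither intersect nor are adjacent. A tubing of $G$ is a set of pairwise compatible tubes of $G$ that contains the universal tube and, if $G$ is disconnected, does not contain all of the tubes given by the node sets of the connected components of $G$. A marked tubing of $G$ is a tubing together with an assignment to each of its tubes of exactly one of the markings thin, thick, broken, such that whenever $u\subsetneq v$ are tubes of the tubing and $v$ is not thick, then $u$ is thin. In a tubing, $u$ is closely nested in $v$, written $u\Subset v$, if $u\subsetneq v$ and no tube $u'$ of the tubing satisfies $u\subsetneq u'\subsetneq v$. Order on marked tubings: $U\preceq U'$ if $U$ is obtained from $U'$ by a finite (possibly empty) sequence of the following moves, each producing again a marked tubing: (1) a broken tube becomes thin or becomes thick; (2) a thin tube is added inside a thin tube or inside a broken tube; (3) a thick tube is added inside a thick tube; (4) a nonempty collection of compatible broken tubes $\{u_1,\dots,u_m\}$ is added simultaneously inside a broken tube $v$, with $u_i\Subset v$ for all $i$ in the resulting tubing, and at the same time $v$ becomes thick. The graph multiplihedron $\mathcal{J}G$ of a graph $G$ with $n$ nodes is the $n$-dimensional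 convex polytope (unique up to combinatorial equivalence) whose face poset (nonempty faces, including the polytope itself, ordered by inclusion) is isomorphic to the poset of marked tubings of $G$ under $\preceq$. A $d$-dimensional polytope is simple if each of its vertices is contained in exactly $d$ edges.
   Formalization: The graph consisting of two isolated nodes is excluded: its graph multiplihedron is a hexagon, a simple polytope, although the graph is not complete, so the claim as stated fails for exactly that graph. *)

theory Defs
  imports
    "HOL-Analysis.Polytope"
    "Graph_Theory.Digraph_Component"
    "Graph_Theory.Kuratowski"
begin

section \<open>Tubes and tubings\<close>

text \<open>
  Finite simple graphs are modelled as in the Graph-Theory library, by the locale predicate
  \<^const>\<open>graph\<close>: finite symmetric digraphs without loops and without parallel arcs.
\<close>

definition tube :: "('a, 'b) pre_digraph \<Rightarrow> 'a set \<Rightarrow> bool" where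
  "tube G u \<longleftrightarrow>
     (u \<noteq> {} \<and> u \<subseteq> verts G \<and> Digraph_Component.connected (G \<restriction> u)) \<or> u = verts G"

text \<open>
  The next three relations concern distinct tubes only; they are always applied through
  \<^const>\<open>pairwise\<close>, which ranges over distinct pairs.
\<close>

definition tubes_intersect :: "'a set \<Rightarrow> 'a set \<Rightarrow> bool" where
  "tubes_intersect u v \<longleftrightarrow> u \<inter> v \<noteq> {} \<and> \<not> u \<subset> v \<and> \<not> v \<subset> u"

definition tubes_adjacent :: "('a, 'b) pre_digraph \<Rightarrow> 'a set \<Rightarrow> 'a set \<Rightarrow> bool" where
  "tubes_adjacent G u v \<longleftrightarrow> u \<inter> v = {} \<and> tube G (u \<union> v)"

definition tubes_compatible :: "('a, 'b) pre_digraph \<Rightarrow> 'a set \<Rightarrow> 'a set \<Rightarrow> bool" where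
  "tubes_compatible G u v \<longleftrightarrow> \<not> tubes_intersect u v \<and> \<not> tubes_adjacent G u v"

text \<open>
  In a symmetric digraph the strongly connected components are the connected components of the
  underlying undirected graph, so \<^term>\<open>pre_digraph.sccs_verts G\<close> is the set of their node sets.
\<close>

definition tubing :: "('a, 'b) pre_digraph \<Rightarrow> 'a set set \<Rightarrow> bool" where
  "tubing G T \<longleftrightarrow>
     (\<forall>u\<in>T. tube G u) \<and> pairwise (tubes_compatible G) T \<and> verts G \<in> T \<and>
     (\<not> Digraph_Component.connected G \<longrightarrow> \<not> pre_digraph.sccs_verts G \<subseteq> T)"

definition closely_nested :: "'a set set \<Rightarrow> 'a set \<Rightarrow> 'a set \<Rightarrow> bool" where
  "closely_nested T u v \<longleftrightarrow> u \<in> T \<and> v \<in> T \<and> u \<subset> v \<and> \<not> (\<exists>w\<in>T. u \<subset> w \<and> w \<subset> v)"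


section \<open>Marked tubings and their order\<close>

datatype marking = Thin | Thick | Broken

text \<open>A marked tubing is a partial map: its domain is the tubing, its values are the markings.\<close>

definition marked_tubing :: "('a, 'b) pre_digraph \<Rightarrow> ('a set \<rightharpoonup> marking) \<Rightarrow> bool" where
  "marked_tubing G M \<longleftrightarrow> tubing G (dom M) \<and>
     (\<forall>u\<in>dom M. \<forall>v\<in>dom M. u \<subset> v \<and> M v \<noteq> Some Thick \<longrightarrow> M u = Some Thin)"

text \<open>\<open>marked_move G M M'\<close>: the marked tubing \<open>M\<close> is obtained from \<open>M'\<close> by a single move.\<close>

inductive marked_move ::
    "('a, 'b) pre_digraph \<Rightarrow> ('a set \<rightharpoonup> marking) \<Rightarrow> ('a set \<rightharpoonup> marking) \<Rightarrow> bool" for G where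
  resolve: "marked_move G (M(u \<mapsto> m)) M"
    if "marked_tubing G M" "marked_tubing G (M(u \<mapsto> m))"
       "M u = Some Broken" "m \<in> {Thin, Thick}"
| add_thin: "marked_move G (M(u \<mapsto> Thin)) M"
    if "marked_tubing G M" "marked_tubing G (M(u \<mapsto> Thin))"
       "u \<notin> dom M" "u \<subset> v" "M v \<in> {Some Thin, Some Broken}"
| add_thick: "marked_move G (M(u \<mapsto> Thick)) M"
    if "marked_tubing G M" "marked_tubing G (M(u \<mapsto> Thick))"
       "u \<notin> dom M" "u \<subset> v" "M v = Some Thick"
| add_broken: "marked_move G M' M"
    if "marked_tubing G M" "marked_tubing G M'"
       "U \<noteq> {}" "U \<inter> dom M = {}" "pairwise (tubes_compatible G) U"
       "M v = Some Broken" "\<forall>u\<in>U. closely_nested (dom M \<union> U) u v"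
       "M' = (\<lambda>w. if w \<in> U then Some Broken else (M(v \<mapsto> Thick)) w)"

definition marked_le ::
    "('a, 'b) pre_digraph \<Rightarrow> ('a set \<rightharpoonup> marking) \<Rightarrow> ('a set \<rightharpoonup> marking) \<Rightarrow> bool" where
  "marked_le G = (marked_move G)\<^sup>*\<^sup>*"


section \<open>The graph multiplihedron\<close>

text \<open>
  The graph multiplihedron is determined up to combinatorial equivalence only, hence a predicate
  singling out its realizations in a Euclidean space of any dimension.
\<close>

definition graph_multiplihedron :: "('a, 'b) pre_digraph \<Rightarrow> 'e::euclidean_space set \<Rightarrow> bool" where
  "graph_multiplihedron G P \<longleftrightarrow>
     polytope P \<and> aff_dim P = int (card (verts G)) \<and>
     (\<exists>\<phi>. bij_betw \<phi> {F. F face_of P \<and> F \<noteq> {}} {M. marked_tubing G M} \<and>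
          (\<forall>F F'. F face_of P \<and> F \<noteq> {} \<and> F' face_of P \<and> F' \<noteq> {} \<longrightarrow>
                  (F \<subseteq> F' \<longleftrightarrow> marked_le G (\<phi> F) (\<phi> F'))))"

definition simple_polytope :: "'e::euclidean_space set \<Rightarrow> bool" where
  "simple_polytope P \<longleftrightarrow> polytope P \<and>
     (\<forall>x. x extreme_point_of P \<longrightarrow> int (card {e. e edge_of P \<and> x \<in> e}) = aff_dim P)"

end

theory Submission
  imports Defs
begin

text \<open>
  Let \<open>a\<close>, \<open>c\<close> be non-adjacent nodes and \<open>d\<close> a third node. Starting from the tubes \<open>{a}\<close> and
  \<open>{c}\<close>, add the nodes other than \<open>d\<close> one by one, each time with a maximal connected set around
  the new node; together with the universal tube this gives a tubing with \<open>n\<close> tubes. Since its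
  proper tubes avoid \<open>d\<close>, no two of them cover the whole graph and they miss the component of \<open>d\<close>.
  Mark all tubes thick. The face of this marked tubing is a vertex, because \<open>n\<close> consecutive moves
  lead to it from the top element. Discarding one of the \<open>n - 1\<close> proper tubes, or turning \<open>{a}\<close> or
  \<open>{c}\<close> broken, yields a marked tubing above it that is \<open>n - 1\<close> moves below the top, hence an edge.
  So this vertex lies on at least \<open>n + 1\<close> edges.
\<close>

section \<open>Tubings with two minimal tubes\<close>

lemma symcl_mono: "R \<subseteq> S \<Longrightarrow> R\<^sup>s \<subseteq> S\<^sup>s"
  by (auto simp: symcl_def)

text \<open>A shared node serves as a hub: every node of the union reaches it, and is reached from
  it, by a walk inside \<open>u\<close> or inside \<open>w\<close>.\<close>

lemma connected_induce_Un:
  assumes "Digraph_Component.connected (G \<restriction> u)" "Digraph_Component.connected (G \<restriction> w)"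
    and "u \<inter> w \<noteq> {}"
  shows "Digraph_Component.connected (G \<restriction> (u \<union> w))"
proof -
  let ?R = "\<lambda>s. rtrancl_on s ((arcs_ends (G \<restriction> s))\<^sup>s)"
  have mono: "?R s \<subseteq> ?R t" if "s \<subseteq> t" for s t
  proof -
    have "arcs_ends (G \<restriction> s) \<subseteq> arcs_ends (G \<restriction> t)"
      using that by (auto simp: arcs_ends_def arc_to_ends_def)
    then show ?thesis
      using rtrancl_on_mono[OF symcl_mono that] by auto
  qed
  obtain z where z: "z \<in> u" "z \<in> w" using assms(3) by blast
  have "(x, z) \<in> ?R (u \<union> w) \<and> (z, x) \<in> ?R (u \<union> w)" if "x \<in> u \<union> w" for x
    using that z assms(1,2) mono[of u "u \<union> w"] mono[of w "u \<union> w"]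
    by (auto simp: connected_conv)
  then show ?thesis
    using z by (auto simp: connected_conv intro: rtrancl_on_trans)
qed

lemma connected_induce_singleton: "Digraph_Component.connected (G \<restriction> {v})"
  by (auto simp: connected_conv)

text \<open>A walk from \<open>a\<close> never leaves \<open>a\<close>: a step to \<open>c\<close>
  would need an arc in one of the two directions, and symmetry turns either into
  \<open>(a, c)\<close>.\<close>

lemma (in sym_digraph) not_connected_induce_pair:
  assumes "a \<noteq> c" "(a, c) \<notin> arcs_ends G"
  shows "\<not> Digraph_Component.connected (G \<restriction> {a, c})"
proof
  assume "Digraph_Component.connected (G \<restriction> {a, c})"
  then have "(a, c) \<in> rtrancl_on {a, c} ((arcs_ends (G \<restriction> {a, c}))\<^sup>s)"
    by (auto simp: connected_conv)
  then have "c = a"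
  proof (induction rule: rtrancl_on_induct)
    case (step y z)
    have "(y, z) \<in> arcs_ends G \<or> (z, y) \<in> arcs_ends G"
      using step.hyps(2) by (auto simp: symcl_def arcs_ends_def arc_to_ends_def)
    then have "(y, z) \<in> arcs_ends G"
      using graph_symmetric by blast
    then show ?case
      using step.hyps step.IH assms by auto
  qed simp
  with assms show False by simp
qed

text \<open>Agrees with \<open>tubes_compatible\<close> on distinct nonempty sets of nodes whose
  union is not all of \<open>verts G\<close>. Phrased by connectedness alone, it makes no exception
  for the universal tube, so a family can be built node by node.\<close>

definition separated_or_nested :: "('a, 'b) pre_digraph \<Rightarrow> 'a set \<Rightarrow> 'a set \<Rightarrow> bool" where
  "separated_or_nested G u w \<longleftrightarrow>
     u \<subseteq> w \<or> w \<subseteq> u \<or> (u \<inter> w = {} \<and> \<not> Digraph_Component.connected (G \<restriction> (u \<union> w)))"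

lemma separated_or_nested_commute: "separated_or_nested G u w \<Longrightarrow> separated_or_nested G w u"
  by (auto simp: separated_or_nested_def Un_commute Int_commute)

text \<open>Induction on \<open>A\<close>. The set \<open>C\<close> chosen for a new node
  \<open>v\<close> is maximal among the connected sets containing \<open>v\<close>, so each earlier
  set is either swallowed by \<open>C\<close> or separated from it.\<close>

lemma nested_family_exists:
  assumes "finite A" "a \<noteq> c" "\<not> Digraph_Component.connected (G \<restriction> {a, c})" "a \<notin> A" "c \<notin> A"
  shows "\<exists>F. {a} \<in> F \<and> {c} \<in> F \<and> finite F \<and> card F = card A + 2 \<and>
    (\<forall>u\<in>F. u \<noteq> {} \<and> u \<subseteq> insert a (insert c A) \<and> Digraph_Component.connected (G \<restriction> u)) \<and>
    pairwise (separated_or_nested G) F"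
  using assms(1,4,5)
proof (induction A rule: finite_induct)
  case empty
  have "pairwise (separated_or_nested G) {{a}, {c}}"
    using assms(2,3) by (auto simp: pairwise_def separated_or_nested_def insert_commute)
  then show ?case
    using assms(2) connected_induce_singleton
    by (intro exI[of _ "{{a}, {c}}"]) auto
next
  case (insert v A)
  let ?S = "insert a (insert c A)"
  obtain F where F: "{a} \<in> F" "{c} \<in> F" "finite F" "card F = card A + 2"
      "\<And>u. u \<in> F \<Longrightarrow> u \<noteq> {} \<and> u \<subseteq> ?S \<and> Digraph_Component.connected (G \<restriction> u)"
      "pairwise (separated_or_nested G) F"
    using insert by auto
  let ?\<C> = "{C. v \<in> C \<and> C \<subseteq> insert v ?S \<and> Digraph_Component.connected (G \<restriction> C)}"
  have "finite ?\<C>"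
    by (rule finite_subset[of _ "Pow (insert v ?S)"]) (use insert.hyps in auto)
  moreover have "{v} \<in> ?\<C>"
    using connected_induce_singleton by auto
  ultimately obtain C where C: "C \<in> ?\<C>" and max: "\<And>D. D \<in> ?\<C> \<Longrightarrow> C \<subseteq> D \<Longrightarrow> D = C"
    using finite_has_maximal[of ?\<C>] by (metis (no_types, lifting) empty_iff)
  have absorb: "u \<subseteq> C" if "u \<in> F" "Digraph_Component.connected (G \<restriction> (u \<union> C))" for u
  proof -
    have "u \<union> C \<in> ?\<C>" using that C F(5)[OF that(1)] by blast
    then show ?thesis using max[of "u \<union> C"] by blast
  qed
  \<comment> \<open>If \<open>u\<close> meets \<open>C\<close>, their union is connected and
    \<open>absorb\<close> applies.\<close>
  have sep: "separated_or_nested G u C" if "u \<in> F" for u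
    using absorb[OF that] connected_induce_Un[of G u C] F(5)[OF that] C
    unfolding separated_or_nested_def by blast
  \<comment> \<open>The earlier sets all miss \<open>v\<close>, so the count grows by one.\<close>
  have "C \<notin> F" using C F(5) insert by blast
  moreover have "pairwise (separated_or_nested G) (insert C F)"
    using F(6) sep separated_or_nested_commute by (auto simp: pairwise_insert)
  ultimately show ?case
    using F C insert.hyps by (intro exI[of _ "insert C F"]) auto
qed

lemma (in graph) tubing_exists:
  assumes "a \<in> verts G" "c \<in> verts G" "a \<noteq> c" "(a, c) \<notin> arcs_ends G" "card (verts G) \<ge> 3"
  shows "\<exists>F. finite F \<and> card F + 1 = card (verts G) \<and> verts G \<notin> F \<and> {a} \<in> F \<and> {c} \<in> F \<and>
    tubing G (insert (verts G) F)"
proof -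
  have "\<not> verts G \<subseteq> {a, c}"
    using assms(3,5) card_mono[of "{a, c}" "verts G"] by auto
  then obtain d where d: "d \<in> verts G" "d \<noteq> a" "d \<noteq> c" by blast
  \<comment> \<open>With n nodes this leaves n - 3, so the family has (n - 3) + 2 = n - 1
    members.\<close>
  let ?A = "verts G - {a, c, d}"
  have card: "card ?A + 3 = card (verts G)"
    using d assms by (subst card_Diff_subset) auto
  have S: "insert a (insert c ?A) = verts G - {d}"
    using d assms by auto
  have "finite ?A" "a \<notin> ?A" "c \<notin> ?A" by auto
  then obtain F where F: "{a} \<in> F" "{c} \<in> F" "finite F" "card F = card ?A + 2"
      "\<And>u. u \<in> F \<Longrightarrow> u \<noteq> {} \<and> u \<subseteq> verts G - {d} \<and> Digraph_Component.connected (G \<restriction> u)"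
      "pairwise (separated_or_nested G) F"
    using nested_family_exists[OF _ assms(3) not_connected_induce_pair[OF assms(3,4)], of ?A]
    unfolding S by auto
  have V: "verts G \<notin> F" using F(5) d by blast
  have "tube G u" if "u \<in> insert (verts G) F" for u
    using that F(5) by (auto simp: tube_def)
  moreover have "pairwise (tubes_compatible G) (insert (verts G) F)"
  proof -
    have "tubes_compatible G u w" if "u \<in> F" "w \<in> F" "u \<noteq> w" for u w
    proof -
      \<comment> \<open>Disjoint sets covering \<open>verts G\<close> would be adjacent even if
        their union were disconnected, since the universal set is always a tube.\<close>
      have "u \<union> w \<noteq> verts G" using F(5) that d by blast
      then show ?thesis
        using F(5)[OF that(1)] F(5)[OF that(2)] pairwiseD[OF F(6) that] that
        unfolding tubes_compatible_def tubes_intersect_def tubes_adjacent_def tube_def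
          separated_or_nested_def
        by (metis inf.absorb1 inf.absorb2 psubsetI)
    qed
    moreover have "tubes_compatible G (verts G) u \<and> tubes_compatible G u (verts G)" if "u \<in> F" for u
    proof -
      have "u \<subset> verts G" "u \<noteq> {}" using F(5)[OF that] d by auto
      then show ?thesis
        unfolding tubes_compatible_def tubes_intersect_def tubes_adjacent_def by blast
    qed
    ultimately show ?thesis by (auto simp: pairwise_def)
  qed
  moreover have "\<not> sccs_verts \<subseteq> insert (verts G) F" if nc: "\<not> Digraph_Component.connected G"
  proof
    assume sub: "sccs_verts \<subseteq> insert (verts G) F"
    have scc: "scc_of d \<in> sccs_verts" "d \<in> scc_of d"
      using d by (auto intro: scc_of_in_sccs_verts in_scc_of_self)
    \<comment> \<open>The component of \<open>d\<close> can then only be the universal tube, which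
      would make the graph connected.\<close>
    have "scc_of d \<notin> F" using F(5)[of "scc_of d"] scc(2) by blast
    then have "verts G \<in> sccs_verts" using sub scc(1) by (metis insertE subsetD)
    then have "(x, y) \<in> rtrancl_on (verts G) (arcs_ends G)" if "x \<in> verts G" "y \<in> verts G" for x y
      using that by (auto simp: in_sccs_verts_conv_reachable reachable_def)
    moreover have "rtrancl_on (verts G) (arcs_ends G) \<subseteq> rtrancl_on (verts G) ((arcs_ends G)\<^sup>s)"
      using rtrancl_on_mono[of "arcs_ends G" "(arcs_ends G)\<^sup>s" "verts G" "verts G"]
      by (auto simp: symcl_def)
    ultimately have "Digraph_Component.connected G"
      using d by (auto simp: connected_conv)
    with nc show False by simp
  qed
  ultimately have "tubing G (insert (verts G) F)"
    by (simp add: tubing_def)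
  then show ?thesis using F card V by auto
qed

text \<open>The component condition forbids an inclusion, so it passes to subfamilies like the
  pairwise conditions.\<close>

lemma tubing_subset:
  assumes "tubing G T" "S \<subseteq> T" "verts G \<in> S"
  shows "tubing G S"
  using assms pairwise_subset unfolding tubing_def by blast

lemma tubing_proper_subset_verts:
  assumes "tubing G T" "u \<in> T" "u \<noteq> verts G"
  shows "u \<subset> verts G"
  using assms by (auto simp: tubing_def tube_def)


section \<open>Thick markings\<close>

definition all_thick :: "'a set set \<Rightarrow> 'a set \<rightharpoonup> marking" where
  "all_thick T = (\<lambda>u. if u \<in> T then Some Thick else None)"

abbreviation broken_at :: "'a set set \<Rightarrow> 'a set \<Rightarrow> 'a set \<rightharpoonup> marking" where
  "broken_at T b \<equiv> (all_thick T)(b \<mapsto> Broken)"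

lemma dom_all_thick [simp]: "dom (all_thick T) = T"
  by (auto simp: all_thick_def split: if_splits)

lemma marked_tubing_all_thick:
  assumes "tubing G T" shows "marked_tubing G (all_thick T)"
  using assms unfolding marked_tubing_def dom_all_thick by (simp add: all_thick_def)

text \<open>Only \<open>b\<close> is not thick, and no tube lies below it, so the marking condition
  is vacuous.\<close>

lemma marked_tubing_broken_at:
  assumes "tubing G T" "b \<in> T" "\<not> (\<exists>u\<in>T. u \<subset> b)"
  shows "marked_tubing G (broken_at T b)"
proof -
  have "dom (broken_at T b) = T"
    using assms(2) by (simp add: insert_absorb)
  moreover have "v = b" if "v \<in> T" "broken_at T b v \<noteq> Some Thick" for v
    using that by (metis all_thick_def fun_upd_other)
  ultimately show ?thesis
    using assms(1,3) unfolding marked_tubing_def by metis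
qed

section \<open>Moves between markings without thin tubes\<close>

lemma move_all_thick_insert:
  assumes "tubing G (insert u S)" "u \<notin> S" "verts G \<in> S"
  shows "marked_move G (all_thick (insert u S)) (all_thick S)"
proof -
  have eq: "all_thick (insert u S) = (all_thick S)(u \<mapsto> Thick)"
    by (auto simp: all_thick_def)
  have S: "tubing G S" using tubing_subset[OF assms(1)] assms(3) by blast
  \<comment> \<open>The universal tube is the thick tube inside which \<open>u\<close> is
    added.\<close>
  have "u \<subset> verts G" using tubing_proper_subset_verts[OF assms(1)] assms by blast
  then show ?thesis
    using marked_move.add_thick[of G "all_thick S" u "verts G"] assms
      marked_tubing_all_thick[OF S] marked_tubing_all_thick[OF assms(1)]
    by (simp add: eq[symmetric]) (simp add: all_thick_def)
qed

lemma move_broken_at_insert: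
  assumes "tubing G (insert u S)" "u \<notin> S" "verts G \<in> S" "b \<in> S" "b \<noteq> verts G"
    and "\<not> (\<exists>w\<in>insert u S. w \<subset> b)"
  shows "marked_move G (broken_at (insert u S) b) (broken_at S b)"
proof -
  have eq: "broken_at (insert u S) b = (broken_at S b)(u \<mapsto> Thick)"
    using assms by (auto simp: all_thick_def fun_eq_iff)
  have S: "tubing G S" using tubing_subset[OF assms(1)] assms(3) by blast
  have "u \<subset> verts G" using tubing_proper_subset_verts[OF assms(1)] assms by blast
  then show ?thesis
    using marked_move.add_thick[of G "broken_at S b" u "verts G"] assms
      marked_tubing_broken_at[OF S, of b] marked_tubing_broken_at[OF assms(1), of b]
    by (simp add: eq[symmetric] insert_absorb) (simp add: all_thick_def)
qed

lemma move_all_thick_broken_at: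
  assumes "tubing G T" "b \<in> T" "\<not> (\<exists>u\<in>T. u \<subset> b)"
  shows "marked_move G (all_thick T) (broken_at T b)"
proof -
  have eq: "all_thick T = (broken_at T b)(b \<mapsto> Thick)"
    using assms by (auto simp: all_thick_def fun_eq_iff)
  show ?thesis
    by (subst eq, rule resolve)
       (use marked_tubing_broken_at[OF assms] marked_tubing_all_thick[OF assms(1)] eq in auto)
qed

text \<open>Move (4) with the one-element collection \<open>{b}\<close>: a single move adds
  \<open>b\<close> as a broken tube and thickens the universal tube.\<close>

lemma move_broken_at_top:
  assumes "tubing G {verts G, b}" "b \<noteq> verts G"
  shows "marked_move G (broken_at {verts G, b} b) (broken_at {verts G} (verts G))"
proof (rule add_broken[where U = "{b}" and v = "verts G"])
  have b: "b \<subset> verts G" using tubing_proper_subset_verts[OF assms(1)] assms(2) by blast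
  show "marked_tubing G (broken_at {verts G} (verts G))"
    by (rule marked_tubing_broken_at[OF tubing_subset[OF assms(1)]]) auto
  show "marked_tubing G (broken_at {verts G, b} b)"
    using marked_tubing_broken_at[OF assms(1), of b] b by auto
  show "\<forall>u\<in>{b}. closely_nested (dom (broken_at {verts G} (verts G)) \<union> {b}) u (verts G)"
    using b by (auto simp: closely_nested_def)
qed (use assms in \<open>auto simp: all_thick_def fun_eq_iff split: if_splits\<close>)

text \<open>Either a broken tube changes its marking or a new tube enters the domain. This makes the
  drop in dimension along a move strict.\<close>

lemma marked_move_neq: "marked_move G M' M \<Longrightarrow> M' \<noteq> M"
proof (induction rule: marked_move.induct)
  case (resolve M u m)
  then show ?case by (auto dest: fun_cong[of _ _ u])
next
  case (add_thin M u v)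
  then show ?case by (auto dest!: fun_cong[of _ _ u])
next
  case (add_thick M u v)
  then show ?case by (auto dest!: fun_cong[of _ _ u])
next
  case (add_broken M M' U v)
  then obtain u where "u \<in> U" "u \<notin> dom M" by blast
  then show ?case using add_broken by (auto dest!: fun_cong[of _ _ u])
qed

lemma marked_move_marked_tubing:
  "marked_move G M' M \<Longrightarrow> marked_tubing G M' \<and> marked_tubing G M"
  by (induction rule: marked_move.induct) (rule conjI; assumption)+


section \<open>Dimensions of faces\<close>

text \<open>\<open>face\<close> stands for the inverse of the poset isomorphism: it sends a marked
  tubing to the face of \<open>P\<close> that it labels.\<close>

locale multiplihedron_realization =
  fixes G :: "('a, 'b) pre_digraph" and P :: "'e::euclidean_space set"
    and face :: "('a set \<rightharpoonup> marking) \<Rightarrow> 'e set"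
  assumes polytope: "polytope P"
    and dim: "aff_dim P = int (card (verts G))"
    and face: "marked_tubing G M \<Longrightarrow> face M face_of P \<and> face M \<noteq> {}"
    and face_inj: "inj_on face {M. marked_tubing G M}"
    and face_mono: "marked_tubing G M \<Longrightarrow> marked_tubing G M' \<Longrightarrow> marked_le G M M' \<Longrightarrow> face M \<subseteq> face M'"
begin

lemma move_face_subset: "marked_move G M' M \<Longrightarrow> face M' \<subseteq> face M"
  using face_mono marked_move_marked_tubing unfolding marked_le_def by blast

text \<open>A face contained in a different face is a proper face of it, and proper faces of convex
  sets have smaller dimension.\<close>

lemma move_dim_less:
  assumes "marked_move G M' M"
  shows "aff_dim (face M') < aff_dim (face M)"
proof -
  have m: "marked_tubing G M'" "marked_tubing G M"
    using marked_move_marked_tubing[OF assms] by auto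
  have "face M' \<noteq> face M"
    using inj_onD[OF face_inj] m marked_move_neq[OF assms] by blast
  moreover have "face M' face_of face M"
    using face[OF m(1)] face[OF m(2)] move_face_subset[OF assms]
    by (auto intro: face_of_subset dest: face_of_imp_subset)
  ultimately show ?thesis
    using face[OF m(2)] by (auto intro: face_of_aff_dim_lt face_of_imp_convex)
qed

lemma dim_nonneg:
  assumes "marked_tubing G M"
  shows "0 \<le> aff_dim (face M)"
  using face[OF assms] aff_dim_negative_iff[of "face M"] by linarith

lemma dim_top:
  assumes "tubing G {verts G}"
  shows "aff_dim (face (broken_at {verts G} (verts G))) \<le> int (card (verts G))"
proof -
  have "marked_tubing G (broken_at {verts G} (verts G))"
    by (rule marked_tubing_broken_at[OF assms]) simp_all
  then show ?thesis
    unfolding dim[symmetric] by (intro aff_dim_subset face_of_imp_subset conjunct1[OF face])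
qed

text \<open>Counts moves from the marking with only a broken universal tube: one thickens that tube,
  giving the strict inequality, and each member of \<open>A\<close> costs one more.\<close>

lemma dim_all_thick:
  assumes "finite A" "verts G \<notin> A" "tubing G (insert (verts G) A)"
  shows "aff_dim (face (all_thick (insert (verts G) A))) + int (card A) < int (card (verts G))"
  using assms
proof (induction A rule: finite_induct)
  case empty
  then have "marked_move G (all_thick {verts G}) (broken_at {verts G} (verts G))"
    by (intro move_all_thick_broken_at) auto
  from move_dim_less[OF this] show ?case
    using dim_top[OF empty(2)] by simp
next
  case (insert u A)
  have "tubing G (insert (verts G) A)"
    by (rule tubing_subset[OF insert.prems(2)]) auto
  then have IH: "aff_dim (face (all_thick (insert (verts G) A))) + int (card A)
      < int (card (verts G))"
    using insert.IH insert.prems by blast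
  have eq: "insert (verts G) (insert u A) = insert u (insert (verts G) A)" by blast
  have "marked_move G (all_thick (insert (verts G) (insert u A))) (all_thick (insert (verts G) A))"
    unfolding eq
    by (rule move_all_thick_insert) (use insert.prems insert.hyps in \<open>auto simp: insert_commute\<close>)
  from move_dim_less[OF this] show ?case
    using IH insert.hyps by simp
qed

text \<open>The first move inserts \<open>b\<close> and thickens the universal tube at once, so
  \<open>b\<close> costs no extra move and does not enter the count.\<close>

lemma dim_broken_at:
  assumes "finite A" "verts G \<notin> A" "b \<notin> A" "b \<noteq> verts G"
    and "tubing G (insert (verts G) (insert b A))" "\<not> (\<exists>u\<in>insert b A. u \<subset> b)"
  shows "aff_dim (face (broken_at (insert (verts G) (insert b A)) b)) + int (card A)
    < int (card (verts G))"
  using assms(1,2,3,5,6)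
proof (induction A rule: finite_induct)
  case empty
  have "tubing G {verts G}" by (rule tubing_subset[OF empty(3)]) auto
  show ?case
    using move_dim_less[OF move_broken_at_top[OF empty(3) assms(4)]] dim_top[OF \<open>tubing G {verts G}\<close>]
    unfolding card.empty of_nat_0 by linarith
next
  case (insert u A)
  let ?S = "insert (verts G) (insert b A)"
  have eq: "insert (verts G) (insert b (insert u A)) = insert u ?S" by blast
  have b: "b \<subset> verts G"
    using tubing_proper_subset_verts[OF insert.prems(3)] assms(4) by blast
  have "tubing G ?S"
    by (rule tubing_subset[OF insert.prems(3)]) auto
  then have IH: "aff_dim (face (broken_at ?S b)) + int (card A) < int (card (verts G))"
    using insert.IH insert.prems by blast
  have "marked_move G (broken_at (insert u ?S) b) (broken_at ?S b)"
  proof (rule move_broken_at_insert)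
    show "tubing G (insert u ?S)" using insert.prems(3) unfolding eq .
    show "u \<notin> ?S" using insert.hyps insert.prems(1,2) by blast
    show "\<not> (\<exists>w\<in>insert u ?S. w \<subset> b)" using insert.prems(4) b by blast
  qed (use assms(4) in auto)
  from move_dim_less[OF this] show ?case
    using IH card_insert_disjoint[OF insert.hyps] unfolding eq by linarith
qed

lemma vertex_with_too_many_edges:
  assumes F: "finite F" "card F + 1 = card (verts G)" "verts G \<notin> F"
    and tubing: "tubing G (insert (verts G) F)"
    and bc: "{a} \<in> F" "{c} \<in> F" "a \<noteq> c"
    and nonempty: "{} \<notin> F"
  shows "\<exists>x. x extreme_point_of P \<and> card {e. e edge_of P \<and> x \<in> e} > card (verts G)"
proof -
  let ?T = "insert (verts G) F"
  let ?m = "all_thick ?T"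
  define N where "N = (\<lambda>u. all_thick (insert (verts G) (F - {u}))) ` F"
  define B where "B = {broken_at ?T {a}, broken_at ?T {c}}"
  have m: "marked_tubing G ?m" by (rule marked_tubing_all_thick[OF tubing])
  \<comment> \<open>The n - 1 proper tubes leave a dimension below 1, and the face is
    nonempty.\<close>
  have "aff_dim (face ?m) = 0"
    using dim_all_thick[OF F(1,3) tubing] F(2) dim_nonneg[OF m] by linarith
  then obtain x where x: "face ?m = {x}"
    using aff_dim_eq_0 by blast
  have card_le: "card F \<ge> 1" using F(1) bc card_gt_0_iff[of F] by fastforce
  have edge_moves: "marked_move G ?m M \<and> aff_dim (face M) \<le> 1" if "M \<in> N \<union> B" for M
  proof -
    consider u where "u \<in> F" "M = all_thick (insert (verts G) (F - {u}))"
      | s where "s \<in> {a, c}" "M = broken_at ?T {s}"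
      using \<open>M \<in> N \<union> B\<close> unfolding N_def B_def by blast
    then show ?thesis
    proof cases
      case 1
      let ?A = "F - {u}"
      have A: "insert u (insert (verts G) ?A) = ?T" using 1 by blast
      have "tubing G (insert (verts G) ?A)" by (rule tubing_subset[OF tubing]) auto
      then have "aff_dim (face M) + int (card ?A) < int (card (verts G))"
        using dim_all_thick[of ?A] F 1 by auto
      moreover have "int (card ?A) = int (card F) - 1"
        using 1 F(1) card_le by simp
      moreover have "marked_move G ?m M"
        using move_all_thick_insert[of G u "insert (verts G) ?A"] 1 F(3) tubing A by auto
      ultimately show ?thesis using F(2) by linarith
    next
      case 2
      let ?A = "F - {{s}}"
      have s: "{s} \<in> F" using 2 bc by blast
      have A: "insert (verts G) (insert {s} ?A) = ?T" using s by blast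
      have sV: "{s} \<noteq> verts G" using s F(3) by auto
      \<comment> \<open>The only proper subset of a singleton is empty, hence neither in
        \<open>F\<close> nor universal.\<close>
      have min: "\<not> (\<exists>u\<in>?T. u \<subset> {s})"
        using nonempty tubing_proper_subset_verts[OF tubing _ sV] s
        by (auto simp: subset_singleton_iff psubset_eq)
      have "aff_dim (face M) + int (card ?A) < int (card (verts G))"
        using dim_broken_at[of ?A "{s}"] F 2 A sV min tubing by auto
      moreover have "int (card ?A) = int (card F) - 1"
        using s F(1) card_le by simp
      moreover have "marked_move G ?m M"
        unfolding 2(2) using move_all_thick_broken_at[OF tubing _ min] s by blast
      ultimately show ?thesis using F(2) by linarith
    qed
  qed
  have "face M edge_of P \<and> x \<in> face M" if "M \<in> N \<union> B" for M
  proof -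
    have move: "marked_move G ?m M" and le: "aff_dim (face M) \<le> 1" using edge_moves[OF that] by auto
    \<comment> \<open>The chain of moves bounds the dimension by 1 from above; the strict drop to
      the vertex makes it positive.\<close>
    then have "aff_dim (face M) = 1"
      using move_dim_less[OF move] \<open>aff_dim (face ?m) = 0\<close> by linarith
    then show ?thesis
      using move_face_subset[OF move] x face marked_move_marked_tubing[OF move]
      by (auto simp: edge_of_def)
  qed
  then have sub: "face ` (N \<union> B) \<subseteq> {e. e edge_of P \<and> x \<in> e}" by blast
  have fin: "finite {e. e edge_of P \<and> x \<in> e}"
    by (rule finite_subset[OF _ finite_polytope_faces[OF polytope]]) (auto simp: edge_of_def)
  have "inj_on (\<lambda>u. all_thick (insert (verts G) (F - {u}))) F"
  proof (rule inj_onI)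
    fix u w assume uw: "u \<in> F" "w \<in> F"
      and "all_thick (insert (verts G) (F - {u})) = all_thick (insert (verts G) (F - {w}))"
    then have "insert (verts G) (F - {u}) = insert (verts G) (F - {w})"
      by (metis dom_all_thick)
    then show "u = w" using uw F(3) by blast
  qed
  then have "card N = card F" unfolding N_def by (rule card_image)
  moreover have "card B = 2"
    using bc(3) by (auto simp: B_def all_thick_def fun_eq_iff card_insert_if split: if_splits)
  moreover have "N \<inter> B = {}"
  proof -
    have "Some Broken \<notin> range M" if "M \<in> N" for M
      using that by (auto simp: N_def all_thick_def split: if_splits)
    moreover have "Some Broken \<in> range M" if "M \<in> B" for M
      using that by (auto simp: B_def)
    ultimately show ?thesis by blast
  qed
  moreover have "finite N" "finite B" using F(1) by (auto simp: N_def B_def)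
  \<comment> \<open>This is n + 1, one more than simplicity allows.\<close>
  ultimately have "card (N \<union> B) = card F + 2" by (simp add: card_Un_disjoint)
  moreover have "card (face ` (N \<union> B)) = card (N \<union> B)"
    using inj_on_subset[OF face_inj] edge_moves marked_move_marked_tubing
    by (intro card_image) blast
  ultimately have "card {e. e edge_of P \<and> x \<in> e} > card (verts G)"
    using card_mono[OF fin sub] F(2) by linarith
  moreover have "x extreme_point_of P"
    using face[OF m] x by (simp add: face_of_singleton)
  ultimately show ?thesis by blast
qed

end

section \<open>From realizations of the face poset to complete graphs\<close>

lemma graph_multiplihedron_realization:
  assumes "graph_multiplihedron G P"
  shows "\<exists>face. multiplihedron_realization G P face"
proof -
  let ?\<F> = "{F. F face_of P \<and> F \<noteq> {}}"
  obtain \<phi> where \<phi>: "bij_betw \<phi> ?\<F> {M. marked_tubing G M}"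
    and le: "\<And>F F'. F \<in> ?\<F> \<Longrightarrow> F' \<in> ?\<F> \<Longrightarrow> F \<subseteq> F' \<longleftrightarrow> marked_le G (\<phi> F) (\<phi> F')"
    using assms unfolding graph_multiplihedron_def by auto
  let ?face = "inv_into ?\<F> \<phi>"
  have bij: "bij_betw ?face {M. marked_tubing G M} ?\<F>"
    by (rule bij_betw_inv_into[OF \<phi>])
  have face: "?face M \<in> ?\<F>" "\<phi> (?face M) = M" if "marked_tubing G M" for M
    using that bij_betwE[OF bij] bij_betw_inv_into_right[OF \<phi>] by auto
  have "multiplihedron_realization G P ?face"
  proof
    show "polytope P" "aff_dim P = int (card (verts G))"
      using assms by (auto simp: graph_multiplihedron_def)
    show "inj_on ?face {M. marked_tubing G M}"
      using bij by (rule bij_betw_imp_inj_on)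
    show "?face M face_of P \<and> ?face M \<noteq> {}" if "marked_tubing G M" for M
      using face(1)[OF that] by blast
    show "?face M \<subseteq> ?face M'"
      if "marked_tubing G M" "marked_tubing G M'" "marked_le G M M'" for M M'
      using le[OF face(1)[OF that(1)] face(1)[OF that(2)]] face(2) that by simp
  qed
  then show ?thesis by blast
qed

theorem corollary9:
  fixes G :: "('a, 'b) pre_digraph" and P :: "'e::euclidean_space set"
  assumes "graph G" and "verts G \<noteq> {}"
    and "\<not> (card (verts G) = 2 \<and> arcs G = {})"
    and "graph_multiplihedron G P" and "simple_polytope P"
  shows "K\<^bsub>card (verts G)\<^esub> G"
proof (rule ccontr)
  interpret graph G by fact
  assume "\<not> K\<^bsub>card (verts G)\<^esub> G"
  then have "arcs_ends G \<noteq> {(u, v). (u, v) \<in> verts G \<times> verts G \<and> u \<noteq> v}"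
    using assms(1) by (simp add: complete_digraph_def)
  moreover have "arcs_ends G \<subseteq> {(u, v). (u, v) \<in> verts G \<times> verts G \<and> u \<noteq> v}"
    by (auto dest: adj_in_verts adj_not_same)
  ultimately obtain a c where ac: "a \<in> verts G" "c \<in> verts G" "a \<noteq> c" "(a, c) \<notin> arcs_ends G"
    by blast
  \<comment> \<open>Without a third node the graph would be edgeless on two nodes. That case is
    excluded by hypothesis: its multiplihedron is a polygon, hence simple.\<close>
  have "card (verts G) \<ge> 3"
  proof (rule ccontr)
    assume "\<not> ?thesis"
    moreover have "card {a, c} \<le> card (verts G)"
      using ac by (intro card_mono) auto
    ultimately have two: "card (verts G) = 2" using ac(3) by simp
    then have V: "verts G = {a, c}"
      using ac card_subset_eq[of "verts G" "{a, c}"] by auto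
    have "(c, a) \<notin> arcs_ends G" using ac(4) graph_symmetric by blast
    have "(x, y) \<notin> arcs_ends G" for x y
    proof
      assume xy: "(x, y) \<in> arcs_ends G"
      then have "x \<in> {a, c}" "y \<in> {a, c}" "x \<noteq> y"
        unfolding V[symmetric] by (auto dest: adj_in_verts adj_not_same)
      then show False
        using xy ac(4) \<open>(c, a) \<notin> arcs_ends G\<close> by auto
    qed
    then have "arcs_ends G = {}" by auto
    then show False using assms(3) two by (simp add: arcs_ends_def)
  qed
  from tubing_exists[OF ac this] obtain F where F: "finite F" "card F + 1 = card (verts G)"
      "verts G \<notin> F" "{a} \<in> F" "{c} \<in> F" "tubing G (insert (verts G) F)"
    by blast
  \<comment> \<open>The empty set could be a tube only as the universal one, but there are
    nodes.\<close>
  have "{} \<notin> F"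
    using F(6) assms(2) by (auto simp: tubing_def tube_def)
  obtain face where "multiplihedron_realization G P face"
    using graph_multiplihedron_realization[OF assms(4)] by blast
  then interpret multiplihedron_realization G P face .
  obtain x where "x extreme_point_of P" "card {e. e edge_of P \<and> x \<in> e} > card (verts G)"
    using vertex_with_too_many_edges[OF F(1,2,3,6,4,5) ac(3) \<open>{} \<notin> F\<close>] by blast
  moreover from this have "int (card {e. e edge_of P \<and> x \<in> e}) = int (card (verts G))"
    using assms(5) dim unfolding simple_polytope_def by metis
  ultimately show False by linarith
qed

end
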